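(* Let $\mathcal{H}$ be a complex Hilbert space and let $A\in\mathbb{B}(\mathcal{H})$ be positive contractive. Then for all $x,y\in\mathcal{H}$, \[ |\langle x,y\rangle|+\sqrt{\langle Ax,x\rangle\langle Ay,y\rangle}-|\langle Ax,y\rangle|\le \|x\|\,\|y\|. \] In particular, if $A\in\mathbb{B}(\mathcal{H})$ is any nonzero positive operator, then for all $x,y\in\mathcal{H}$, \[ |\langle x,y\rangle|+\frac{1}{\|A\|}\Big(\sqrt{\langle Ax,x\rangle\langle Ay,y\rangle}-|\langle Ax,y\rangle|\Big)\le \|x\|\,\|y\|. \]
   Context: $\mathbb{B}(\mathcal{H})$ is the algebra of all bounded linear operators on $\mathcal{H}$, with operator norm $\|A\|=\sup_{\|x\|=1}\|Ax\|$. An operator $A\in\mathbb{B}(\mathcal{H})$ is positive ($A\ge0$) if $\langle Ax,x\rangle\ge0$ for all $x\in\mathcal{H}$; for self-adjoint $A,B$, $A\le B$ means $B-A\ge0$. $A$ is positive contractive if $0\le A\le I$, where $I$ is the identity operator. *)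

theory Defs
  imports "HOL-Analysis.Analysis"
begin

class complex_vector = real_vector +
  fixes scaleC :: "complex \<Rightarrow> 'a \<Rightarrow> 'a"  (infixr "*\<^sub>C" 75)
  assumes scaleC_add_right: "c *\<^sub>C (x + y) = c *\<^sub>C x + c *\<^sub>C y"
    and scaleC_add_left: "(c + d) *\<^sub>C x = c *\<^sub>C x + d *\<^sub>C x"
    and scaleC_scaleC: "c *\<^sub>C (d *\<^sub>C x) = (c * d) *\<^sub>C x"
    and scaleC_of_real: "complex_of_real r *\<^sub>C x = r *\<^sub>R x"

text \<open>The inner product is linear in the first argument.\<close>

class complex_inner = complex_vector + real_normed_vector +
  fixes cinner :: "'a \<Rightarrow> 'a \<Rightarrow> complex"
  assumes cinner_add_left: "cinner (x + y) z = cinner x z + cinner y z"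
    and cinner_scaleC_left: "cinner (c *\<^sub>C x) y = c * cinner x y"
    and cinner_commute: "cinner x y = cnj (cinner y x)"
    and cinner_self_nonneg: "cinner x x \<in> \<real>\<^sub>\<ge>\<^sub>0"
    and cinner_self_eq_0_iff: "cinner x x = 0 \<longleftrightarrow> x = 0"
    and norm_eq_sqrt_cinner: "norm x = sqrt (Re (cinner x x))"

class chilbert_space = complex_inner + complete_space

instantiation complex :: chilbert_space
begin

definition scaleC_complex :: "complex \<Rightarrow> complex \<Rightarrow> complex"
  where "scaleC_complex c x = c * x"

definition cinner_complex :: "complex \<Rightarrow> complex \<Rightarrow> complex"
  where "cinner_complex x y = x * cnj y"

instance
proof
  fix x y z c d :: complex and r :: real
  show "c *\<^sub>C (x + y) = c *\<^sub>C x + c *\<^sub>C y" "(c + d) *\<^sub>C x = c *\<^sub>C x + d *\<^sub>C x"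
    "c *\<^sub>C (d *\<^sub>C x) = (c * d) *\<^sub>C x"
    by (simp_all add: scaleC_complex_def algebra_simps)
  show "complex_of_real r *\<^sub>C x = r *\<^sub>R x"
    by (simp add: scaleC_complex_def scaleR_conv_of_real)
  show "cinner (x + y) z = cinner x z + cinner y z" "cinner (c *\<^sub>C x) y = c * cinner x y"
    "cinner x y = cnj (cinner y x)" "cinner x x = 0 \<longleftrightarrow> x = 0"
    by (simp_all add: cinner_complex_def scaleC_complex_def algebra_simps)
  show "cinner x x \<in> \<real>\<^sub>\<ge>\<^sub>0"
    by (simp add: cinner_complex_def complex_nonneg_Reals_iff)
  show "norm x = sqrt (Re (cinner x x))"
    by (simp add: cinner_complex_def cmod_def power2_eq_square)
qed

end

definition bounded_clinear :: "('a::complex_inner \<Rightarrow> 'a) \<Rightarrow> bool"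
  where "bounded_clinear A \<longleftrightarrow> bounded_linear A \<and> (\<forall>c x. A (c *\<^sub>C x) = c *\<^sub>C A x)"

definition positive_op :: "('a::complex_inner \<Rightarrow> 'a) \<Rightarrow> bool"
  where "positive_op A \<longleftrightarrow> bounded_clinear A \<and> (\<forall>x. cinner (A x) x \<in> \<real>\<^sub>\<ge>\<^sub>0)"

text \<open>Meant for self-adjoint operators. On a complex space, positive operators are
  automatically self-adjoint.\<close>

definition op_le :: "('a::complex_inner \<Rightarrow> 'a) \<Rightarrow> ('a \<Rightarrow> 'a) \<Rightarrow> bool"
  where "op_le A B \<longleftrightarrow> positive_op (\<lambda>x. B x - A x)"

definition positive_contractive :: "('a::complex_inner \<Rightarrow> 'a) \<Rightarrow> bool"
  where "positive_contractive A \<longleftrightarrow> op_le (\<lambda>x. 0) A \<and> op_le A (\<lambda>x. x)"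

end

theory Submission imports Defs begin

text \<open>
  If \<open>0 \<le> A \<le> M I\<close>, then the form of \<open>M I\<close> splits as the sum of the two positive forms
  of \<open>A\<close> and \<open>B = M I - A\<close>. The triangle inequality and the Cauchy--Schwarz inequality for the
  form of \<open>B\<close> give
  \<open>M \<bar>\<langle>x,y\<rangle>\<bar> \<le> \<bar>\<langle>Ax,y\<rangle>\<bar> + \<bar>\<langle>Bx,y\<rangle>\<bar> \<le> \<bar>\<langle>Ax,y\<rangle>\<bar> + sqrt (\<langle>Bx,x\<rangle> \<langle>By,y\<rangle>)\<close>.
  Since \<open>\<langle>Ax,x\<rangle> + \<langle>Bx,x\<rangle> = M \<parallel>x\<parallel>\<^sup>2\<close>, and likewise for \<open>y\<close>, the Cauchy--Schwarz inequality in
  the plane yields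
  \<open>sqrt (\<langle>Ax,x\<rangle> \<langle>Ay,y\<rangle>) + sqrt (\<langle>Bx,x\<rangle> \<langle>By,y\<rangle>) \<le> M \<parallel>x\<parallel> \<parallel>y\<parallel>\<close>, and adding the two estimates gives
  the result for \<open>M\<close> (lemma \<open>positive_op_refined_Cauchy_Schwarz\<close>). A positive contraction is the
  case \<open>M = 1\<close>. A positive operator always satisfies \<open>A \<le> \<parallel>A\<parallel> I\<close>, so \<open>M = \<parallel>A\<parallel>\<close> gives the
  second claim after division by \<open>\<parallel>A\<parallel>\<close>.
\<close>

lemma cinner_add_right: "cinner x (y + z) = cinner x y + cinner x z"
  by (subst (1 2 3) cinner_commute) (simp add: cinner_add_left)

lemma cinner_scaleC_right: "cinner x (c *\<^sub>C y) = cnj c * cinner x y"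
  by (subst (1 2) cinner_commute) (simp add: cinner_scaleC_left)

lemma cinner_scaleR_left: "cinner (r *\<^sub>R x) y = of_real r * cinner x y"
  by (simp add: scaleC_of_real[symmetric] cinner_scaleC_left)

lemma cinner_diff_left: "cinner (x - y) z = cinner x z - cinner y z"
  using cinner_add_left[of "x - y" y z] by simp

lemma scaleC_scaleR_commute: "c *\<^sub>C r *\<^sub>R x = r *\<^sub>R c *\<^sub>C (x :: 'a::complex_vector)"
  by (simp add: scaleC_of_real[symmetric] scaleC_scaleC mult.commute)

lemma scaleC_diff_right: "c *\<^sub>C (x - y) = c *\<^sub>C x - c *\<^sub>C (y :: 'a::complex_vector)"
  using scaleC_add_right[of c "x - y" y] by simp

lemma cinner_self: "cinner x x = complex_of_real ((norm x)\<^sup>2)"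
proof -
  have "Re (cinner x x) \<ge> 0" "Im (cinner x x) = 0"
    using cinner_self_nonneg[of x] by (auto simp: complex_nonneg_Reals_iff)
  then show ?thesis
    by (simp add: norm_eq_sqrt_cinner complex_eq_iff)
qed

lemma bounded_clinear_scaleR_diff:
  assumes "bounded_clinear A"
  shows "bounded_clinear (\<lambda>x. M *\<^sub>R x - A x)"
proof -
  have "bounded_linear (\<lambda>x. M *\<^sub>R x - A x)"
    using assms unfolding bounded_clinear_def
    by (intro bounded_linear_sub bounded_linear_scaleR_right) auto
  then show ?thesis
    using assms
    by (simp add: bounded_clinear_def scaleC_diff_right scaleC_scaleR_commute)
qed

lemma nonneg_quadratic_imp_discriminant:
  fixes a b d :: real
  assumes nonneg: "\<And>t. 0 \<le> a + 2 * t * b + t\<^sup>2 * d" and "0 \<le> d"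
  shows "b\<^sup>2 \<le> a * d"
proof (cases "d = 0")
  case True
  have "b = 0"
  proof (rule ccontr)
    assume "b \<noteq> 0"
    (* an affine function of t with nonzero slope takes the value -1, here at this t *)
    then show False
      using nonneg[of "- (a + 1) / (2 * b)"] True by (simp add: field_simps)
  qed
  then show ?thesis
    using True by simp
next
  case False
  (* the quadratic attains its minimum a - b^2 / d at t = - b / d *)
  then show ?thesis
    using nonneg[of "- b / d"] \<open>0 \<le> d\<close>
    by (simp add: field_simps power2_eq_square)
qed

text \<open>
  Reality of \<open>\<langle>Az,z\<rangle>\<close> at \<open>z = x + y\<close> and \<open>z = x + \<i>y\<close> forces the form of \<open>A\<close> to be Hermitian.
  Rotating \<open>y\<close> by the phase of \<open>\<langle>Ax,y\<rangle>\<close> then makes \<open>\<langle>A(x + ty), x + ty\<rangle>\<close>, for real \<open>t\<close>, a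
  nonnegative quadratic polynomial with middle coefficient \<open>2 \<bar>\<langle>Ax,y\<rangle>\<bar>\<close>.
\<close>

lemma positive_op_Cauchy_Schwarz:
  assumes "positive_op A"
  shows "cmod (cinner (A x) y) \<le> sqrt (Re (cinner (A x) x) * Re (cinner (A y) y))"
proof -
  define s where "s u v = cinner (A u) v" for u v
  have add: "A (u + v) = A u + A v" and scale: "A (c *\<^sub>C u) = c *\<^sub>C A u" for u v c
    using assms by (auto simp: positive_op_def bounded_clinear_def linear_simps)
  have Re_nonneg: "Re (s u u) \<ge> 0" and Im_zero: "Im (s u u) = 0" for u
    using assms by (auto simp: s_def positive_op_def complex_nonneg_Reals_iff)
  have expand: "s (x + c *\<^sub>C y) (x + c *\<^sub>C y)
      = s x x + cnj c * s x y + c * s y x + c * cnj c * s y y" for c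
    by (simp add: s_def add scale cinner_add_left cinner_add_right cinner_scaleC_left
        cinner_scaleC_right algebra_simps)
  have hermitian: "s y x = cnj (s x y)"
    using Im_zero[of "x + 1 *\<^sub>C y"] Im_zero[of "x + \<i> *\<^sub>C y"] Im_zero[of x] Im_zero[of y]
    unfolding expand by (simp add: complex_eq_iff)
  define w where "w = sgn (s x y)"
  have norm_w: "w * cnj w = 1" if "s x y \<noteq> 0"
    using that by (simp add: w_def complex_norm_square[symmetric] norm_sgn)
  have w: "cnj w * s x y = of_real (cmod (s x y))"
  proof (cases "s x y = 0")
    case False
    have "s x y = of_real (cmod (s x y)) * w"
      using False by (simp add: w_def sgn_div_norm scaleR_conv_of_real)
    then have "cnj w * s x y = of_real (cmod (s x y)) * (w * cnj w)"
      by (metis mult.assoc mult.commute)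
    then show ?thesis
      using norm_w[OF False] by simp
  qed simp
  have w': "w * s y x = of_real (cmod (s x y))"
    using arg_cong[OF w, of cnj] by (simp add: hermitian)
  have "(cmod (s x y))\<^sup>2 \<le> Re (s x x) * Re (s y y)"
  proof (cases "s x y = 0")
    case True
    then show ?thesis
      by (simp add: Re_nonneg)
  next
    case False
    have "s (x + (of_real t * w) *\<^sub>C y) (x + (of_real t * w) *\<^sub>C y)
        = s x x + of_real t * (cnj w * s x y) + of_real t * (w * s y x)
          + of_real (t\<^sup>2) * (w * cnj w) * s y y" for t
      unfolding expand by (simp add: algebra_simps power2_eq_square)
    then have "Re (s (x + (of_real t * w) *\<^sub>C y) (x + (of_real t * w) *\<^sub>C y))
        = Re (s x x) + 2 * t * cmod (s x y) + t\<^sup>2 * Re (s y y)" for t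
      unfolding w w' norm_w[OF False] by simp
    then have "0 \<le> Re (s x x) + 2 * t * cmod (s x y) + t\<^sup>2 * Re (s y y)" for t
      using Re_nonneg by metis
    then show ?thesis
      by (rule nonneg_quadratic_imp_discriminant) (rule Re_nonneg)
  qed
  then show ?thesis
    by (auto intro: real_le_rsqrt simp: s_def)
qed

lemma positive_op_id: "positive_op (\<lambda>x. x)"
  by (simp add: positive_op_def bounded_clinear_def bounded_linear_ident cinner_self_nonneg)

lemma cinner_Cauchy_Schwarz: "cmod (cinner x y) \<le> norm x * norm y"
  using positive_op_Cauchy_Schwarz[OF positive_op_id, of x y]
  by (simp add: cinner_self real_sqrt_mult)

text \<open>The Cauchy--Schwarz inequality for the plane vectors \<open>(sqrt a, sqrt a')\<close> and
  \<open>(sqrt b, sqrt b')\<close>.\<close>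

lemma sqrt_mult_add_sqrt_mult_le:
  assumes "0 \<le> a" "0 \<le> b" "0 \<le> a'" "0 \<le> b'"
  shows "sqrt (a * b) + sqrt (a' * b') \<le> sqrt ((a + a') * (b + b'))"
proof -
  have "\<bar>(sqrt a, sqrt a') \<bullet> (sqrt b, sqrt b')\<bar> \<le> norm (sqrt a, sqrt a') * norm (sqrt b, sqrt b')"
    by (rule Cauchy_Schwarz_ineq2)
  then show ?thesis
    using assms by (simp add: norm_Pair real_sqrt_mult)
qed

lemma positive_op_refined_Cauchy_Schwarz:
  assumes A: "positive_op A" and le: "positive_op (\<lambda>x. M *\<^sub>R x - A x)" and "0 \<le> M"
  shows "M * cmod (cinner x y) + sqrt (Re (cinner (A x) x) * Re (cinner (A y) y))
    - cmod (cinner (A x) y) \<le> M * (norm x * norm y)"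
proof -
  define B where "B = (\<lambda>x. M *\<^sub>R x - A x)"
  have split: "of_real M * cinner u v = cinner (A u) v + cinner (B u) v" for u v
    by (simp add: B_def cinner_diff_left cinner_scaleR_left)
  have diag: "Re (cinner (A u) u) + Re (cinner (B u) u) = M * (norm u)\<^sup>2" for u
    using arg_cong[OF split[of u u], of Re] by (simp add: cinner_self)
  have nonneg: "0 \<le> Re (cinner (A u) u)" "0 \<le> Re (cinner (B u) u)" for u
    using A le by (auto simp: B_def positive_op_def complex_nonneg_Reals_iff)
  have "M * cmod (cinner x y) = cmod (cinner (A x) y + cinner (B x) y)"
    using \<open>0 \<le> M\<close> by (simp flip: split add: norm_mult)
  also have "\<dots> \<le> cmod (cinner (A x) y) + cmod (cinner (B x) y)"
    by (rule norm_triangle_ineq)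
  also have "cmod (cinner (B x) y) \<le> sqrt (Re (cinner (B x) x) * Re (cinner (B y) y))"
    using positive_op_Cauchy_Schwarz[OF le] by (simp add: B_def)
  finally have "M * cmod (cinner x y)
      \<le> cmod (cinner (A x) y) + sqrt (Re (cinner (B x) x) * Re (cinner (B y) y))"
    by simp
  moreover have "sqrt (Re (cinner (A x) x) * Re (cinner (A y) y))
      + sqrt (Re (cinner (B x) x) * Re (cinner (B y) y)) \<le> sqrt ((M * (norm x)\<^sup>2) * (M * (norm y)\<^sup>2))"
    unfolding diag[symmetric] by (intro sqrt_mult_add_sqrt_mult_le nonneg)
  moreover have "sqrt ((M * (norm x)\<^sup>2) * (M * (norm y)\<^sup>2)) = M * (norm x * norm y)"
    using \<open>0 \<le> M\<close> by (simp add: real_sqrt_mult)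
  ultimately show ?thesis
    by linarith
qed

lemma positive_op_onorm_diff:
  assumes "positive_op A"
  shows "positive_op (\<lambda>x. onorm A *\<^sub>R x - A x)"
proof -
  have lin: "bounded_linear A" and clin: "bounded_clinear A"
    using assms by (auto simp: positive_op_def bounded_clinear_def)
  have "cinner (onorm A *\<^sub>R x - A x) x \<in> \<real>\<^sub>\<ge>\<^sub>0" for x
  proof -
    have "Re (cinner (A x) x) \<le> norm (A x) * norm x"
      using complex_Re_le_cmod cinner_Cauchy_Schwarz by (rule order_trans)
    also have "\<dots> \<le> onorm A * norm x * norm x"
      using onorm[OF lin] by (intro mult_right_mono) auto
    finally have "Re (cinner (A x) x) \<le> onorm A * (norm x)\<^sup>2"
      by (simp add: power2_eq_square mult.assoc)
    moreover have "Im (cinner (A x) x) = 0"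
      using assms by (auto simp: positive_op_def complex_nonneg_Reals_iff)
    ultimately show ?thesis
      by (simp add: complex_nonneg_Reals_iff cinner_diff_left cinner_scaleR_left cinner_self)
  qed
  then show ?thesis
    using bounded_clinear_scaleR_diff[OF clin] by (simp add: positive_op_def)
qed

theorem corollary3p1:
  shows "(\<forall>A :: 'h::chilbert_space \<Rightarrow> 'h. bounded_clinear A \<and> positive_contractive A \<longrightarrow>
            (\<forall>x y. cmod (cinner x y)
               + sqrt (Re (cinner (A x) x) * Re (cinner (A y) y))
               - cmod (cinner (A x) y) \<le> norm x * norm y))
       \<and> (\<forall>A :: 'h \<Rightarrow> 'h. bounded_clinear A \<and> positive_op A \<and> A \<noteq> (\<lambda>x. 0) \<longrightarrow>
            (\<forall>x y. cmod (cinner x y)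
               + 1 / onorm A * (sqrt (Re (cinner (A x) x) * Re (cinner (A y) y))
                                - cmod (cinner (A x) y)) \<le> norm x * norm y))"
proof (intro conjI allI impI)
  fix A :: "'h \<Rightarrow> 'h" and x y
  assume "bounded_clinear A \<and> positive_contractive A"
  then have "positive_op A" "positive_op (\<lambda>x. 1 *\<^sub>R x - A x)"
    by (auto simp: positive_contractive_def op_le_def)
  then show "cmod (cinner x y) + sqrt (Re (cinner (A x) x) * Re (cinner (A y) y))
      - cmod (cinner (A x) y) \<le> norm x * norm y"
    using positive_op_refined_Cauchy_Schwarz[of A 1 x y] by simp
next
  fix A :: "'h \<Rightarrow> 'h" and x y
  assume A: "bounded_clinear A \<and> positive_op A \<and> A \<noteq> (\<lambda>x. 0)"
  then have "onorm A > 0"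
    by (auto simp: onorm_pos_lt bounded_clinear_def fun_eq_iff)
  moreover have "onorm A * cmod (cinner x y) + sqrt (Re (cinner (A x) x) * Re (cinner (A y) y))
      - cmod (cinner (A x) y) \<le> onorm A * (norm x * norm y)"
    using A \<open>onorm A > 0\<close>
    by (intro positive_op_refined_Cauchy_Schwarz positive_op_onorm_diff) auto
  ultimately show "cmod (cinner x y)
      + 1 / onorm A * (sqrt (Re (cinner (A x) x) * Re (cinner (A y) y)) - cmod (cinner (A x) y))
      \<le> norm x * norm y"
    by (simp add: field_simps)
qed

end
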